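(* The value of $\tilde{\Lambda}_0(2)$ is $$\tilde{\Lambda}_0(2)=1.$$ However, there exists no centrally symmetric planar convex body $K\in\mathcal{K}_0^2$ such that $\tilde{\Lambda}(K)=1$.
   Context: A convex body in $\mathbb{R}^2$ is a compact convex set with non-empty interior; $\mathcal{K}_0^2$ is the set of all centrally symmetric convex bodies in $\mathbb{R}^2$ (i.e. $K=-K$). $|\cdot|$ denotes volume (Lebesgue measure) in the corresponding subspace: area for planar bodies, length for sections by lines. For $w\neq0$ in $\mathbb{R}^2$, $w^\perp$ is the line through the origin orthogonal to $w$. For $K\in\mathcal{K}_0^2$, $$\tilde{\Lambda}(K)=\min\frac{|K|}{|K\cap w_1^\perp|\,|K\cap w_2^\perp|},$$ where the minimum is taken over all orthogonal bases $\{w_1,w_2\}$ of $\mathbb{R}^2$, and $\tilde{\Lambda}_0(2)=\sup_{K\in\mathcal{K}_0^2}\tilde{\Lambda}(K)$. *)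

theory Defs
  imports "HOL-Analysis.Analysis"
begin

definition convex_body :: "'a::euclidean_space set \<Rightarrow> bool" where
  "convex_body K \<longleftrightarrow> compact K \<and> convex K \<and> interior K \<noteq> {}"

definition sym_convex_bodies :: "(real^2) set set" where
  "sym_convex_bodies = {K. convex_body K \<and> uminus ` K = K}"

definition orthogonal_basis :: "real^2 \<Rightarrow> real^2 \<Rightarrow> bool" where
  "orthogonal_basis w1 w2 \<longleftrightarrow>
     independent {w1, w2} \<and> span {w1, w2} = UNIV \<and> orthogonal w1 w2"

definition rot :: "real^2 \<Rightarrow> real^2" where
  "rot w = vector [- w$2, w$1]"

text \<open>
  Rotating \<open>w\<close> by a right angle and normalising gives a unit vector \<open>u\<close> spanning the line
  \<open>{w}\<^sup>\<bottom>\<close>, and \<open>t \<mapsto> t *\<^sub>R u\<close> is an isometric parametrisation of that line.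
  The length of a subset \<open>S\<close> of the line is the one-dimensional Lebesgue measure of its preimage.
  The value does not depend on the choice of \<open>u\<close>; see \<open>line_length_unit\<close> below.
\<close>

definition line_length :: "real^2 \<Rightarrow> (real^2) set \<Rightarrow> real" where
  "line_length w S = measure lebesgue {t::real. t *\<^sub>R (rot w /\<^sub>R norm w) \<in> S}"

definition section_ratio :: "(real^2) set \<Rightarrow> real^2 \<Rightarrow> real^2 \<Rightarrow> real" where
  "section_ratio K w1 w2 =
     measure lebesgue K / (line_length w1 (K \<inter> {w1}\<^sup>\<bottom>) * line_length w2 (K \<inter> {w2}\<^sup>\<bottom>))"

text \<open>
  \<open>LEAST\<close> denotes the minimum of a set of reals, provided that it exists; it does for every
  \<open>K \<in> sym_convex_bodies\<close>, by \<open>Lambda_tilde_attained\<close> and \<open>Lambda_tilde_le\<close> below.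
\<close>

definition Lambda_tilde :: "(real^2) set \<Rightarrow> real" where
  "Lambda_tilde K = (LEAST r. \<exists>w1 w2. orthogonal_basis w1 w2 \<and> r = section_ratio K w1 w2)"

text \<open>The supremum is taken in the extended reals, where it exists without a boundedness proof.\<close>

definition Lambda_tilde_0 :: ereal where
  "Lambda_tilde_0 = (SUP K\<in>sym_convex_bodies. ereal (Lambda_tilde K))"


lemma rot_nth [simp]: "rot w $ 1 = - w$2" "rot w $ 2 = w$1"
  by (simp_all add: rot_def)

lemma inner_2: "(x::real^2) \<bullet> y = x$1 * y$1 + x$2 * y$2"
  by (simp add: inner_vec_def sum_2)

lemma inner_rot_rot [simp]: "rot x \<bullet> rot y = x \<bullet> y"
  by (simp add: inner_2)

lemma norm_rot [simp]: "norm (rot w) = norm w"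
  by (simp add: norm_eq_sqrt_inner)

lemma rot_eq_0_iff [simp]: "rot w = 0 \<longleftrightarrow> w = 0"
  using norm_rot[of w] by (metis norm_eq_zero)

lemma inner_rot_self [simp]: "w \<bullet> rot w = 0"
  by (simp add: inner_2)

lemma rot_rot [simp]: "rot (rot w) = - w"
  by (simp add: vec_eq_iff forall_2)

lemma orthogonal_basis_iff:
  "orthogonal_basis w1 w2 \<longleftrightarrow> w1 \<noteq> 0 \<and> w2 \<noteq> 0 \<and> orthogonal w1 w2"
proof
  assume "orthogonal_basis w1 w2"
  then show "w1 \<noteq> 0 \<and> w2 \<noteq> 0 \<and> orthogonal w1 w2"
    unfolding orthogonal_basis_def using dependent_zero[of "{w1, w2}"] by auto
next
  assume *: "w1 \<noteq> 0 \<and> w2 \<noteq> 0 \<and> orthogonal w1 w2"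
  then have ne: "w1 \<noteq> w2"
    by (auto simp: orthogonal_def)
  have ind: "independent {w1, w2}"
    using * by (intro pairwise_orthogonal_independent)
      (auto simp: pairwise_def orthogonal_commute)
  have "(UNIV :: (real^2) set) \<subseteq> span {w1, w2}"
    by (rule card_ge_dim_independent) (use ind ne in \<open>auto simp: dim_UNIV\<close>)
  then show "orthogonal_basis w1 w2"
    using * ind by (auto simp: orthogonal_basis_def)
qed

lemma orthogonal_plane_cases:
  fixes w e :: "real^2"
  assumes "w \<noteq> 0" "orthogonal w e" "norm e = 1"
  shows "e = rot w /\<^sub>R norm w \<or> e = - (rot w /\<^sub>R norm w)"
proof -
  define u where "u = rot w /\<^sub>R norm w"
  have b: "orthogonal_basis w (rot w)"
    using assms(1) by (auto simp: orthogonal_basis_iff orthogonal_def)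
  define d where "d = e - (e \<bullet> u) *\<^sub>R u"
  have uu: "u \<bullet> u = 1"
    using assms(1) by (simp add: u_def dot_square_norm power2_eq_square)
  have "orthogonal d x" if "x \<in> {w, rot w}" for x
  proof -
    have "u \<bullet> w = 0"
      by (simp add: u_def inner_commute[of _ w])
    then have "d \<bullet> w = 0"
      using assms(2) by (simp add: d_def inner_diff_left orthogonal_def inner_commute[of e w])
    moreover have "d \<bullet> u = 0"
      by (simp add: d_def inner_diff_left uu)
    then have "d \<bullet> rot w = 0"
      using assms(1) by (simp add: u_def)
    ultimately show ?thesis
      using that by (auto simp: orthogonal_def)
  qed
  then have "orthogonal d d"
    using orthogonal_to_span[of d "{w, rot w}" d] b by (auto simp: orthogonal_basis_def)
  then have e: "e = (e \<bullet> u) *\<^sub>R u"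
    by (simp add: d_def orthogonal_def)
  have "norm u = 1"
    using uu by (simp add: norm_eq_sqrt_inner)
  then have "\<bar>e \<bullet> u\<bar> = 1"
    using arg_cong[OF e, of norm] assms(3) by simp
  then have "e \<bullet> u = 1 \<or> e \<bullet> u = -1"
    by linarith
  then show ?thesis
    using e unfolding u_def by auto
qed

lemma line_length_unit:
  assumes "w \<noteq> 0" "orthogonal w e" "norm e = 1"
  shows "line_length w S = measure lebesgue {t::real. t *\<^sub>R e \<in> S}"
proof -
  define u where "u = rot w /\<^sub>R norm w"
  have "measure lebesgue {t::real. t *\<^sub>R (- u) \<in> S} = measure lebesgue {t::real. t *\<^sub>R u \<in> S}"
  proof -
    have "{t::real. t *\<^sub>R (- u) \<in> S} = uminus ` {t::real. t *\<^sub>R u \<in> S}"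
    proof (intro set_eqI iffI)
      fix t :: real
      assume "t \<in> {t. t *\<^sub>R (- u) \<in> S}"
      then show "t \<in> uminus ` {t. t *\<^sub>R u \<in> S}"
        by (intro image_eqI[of _ _ "- t"]) auto
    qed auto
    then show ?thesis
      using measure_lebesgue_affine[of "-1::real" 0 "{t::real. t *\<^sub>R u \<in> S}"] by simp
  qed
  then show ?thesis
    using orthogonal_plane_cases[OF assms] by (auto simp: line_length_def u_def)
qed

lemma sym_convex_body_radius:
  assumes K: "K \<in> sym_convex_bodies" and e: "norm e = 1"
  obtains r where "r > 0" "{t::real. t *\<^sub>R e \<in> K} = {-r..r}"
proof -
  have cpt: "compact K" and cvx: "convex K" and sym: "\<And>x. x \<in> K \<Longrightarrow> - x \<in> K"
    using K by (auto simp: sym_convex_bodies_def convex_body_def)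
  obtain c d where d: "d > 0" "ball c d \<subseteq> K"
    using K by (auto simp: sym_convex_bodies_def convex_body_def mem_interior)
  have ball0: "x \<in> K" if "norm x < d" for x
  proof -
    have "c + x \<in> K" "c - x \<in> K"
      using d that by (auto simp: subset_iff dist_norm)
    then have "(1/2) *\<^sub>R (c + x) + (1/2) *\<^sub>R (- (c - x)) \<in> K"
      using sym[of "c - x"] by (intro convexD[OF cvx]) auto
    moreover have "(1/2) *\<^sub>R (c + x) + (1/2) *\<^sub>R (- (c - x)) = x"
      by (simp add: vec_eq_iff field_simps)
    ultimately show ?thesis by simp
  qed
  define T where "T = {t::real. t *\<^sub>R e \<in> K}"
  have cl: "closed T"
  proof -
    have "T = (\<lambda>t. t *\<^sub>R e) -` K" by (auto simp: T_def)
    moreover have "closed ((\<lambda>t. t *\<^sub>R e) -` K)"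
      by (intro closed_vimage compact_imp_closed cpt continuous_intros)
    ultimately show ?thesis by simp
  qed
  obtain B where B: "\<And>x. x \<in> K \<Longrightarrow> norm x \<le> B"
    using compact_imp_bounded[OF cpt] by (auto simp: bounded_iff)
  have bd: "bounded T"
    unfolding bounded_iff T_def using B e by (intro exI[of _ B]) force
  have ne: "d/2 \<in> T"
    unfolding T_def using ball0[of "(d/2) *\<^sub>R e"] e d by simp
  have "compact T"
    using cl bd by (simp add: compact_eq_bounded_closed)
  then obtain r where r: "r \<in> T" "\<And>t. t \<in> T \<Longrightarrow> t \<le> r"
    using compact_attains_sup[of T] ne by auto
  have symT: "- t \<in> T" if "t \<in> T" for t
    using sym that by (force simp: T_def)
  have rpos: "r > 0"
    using r(2)[OF ne] d by simp
  have "T = {-r..r}"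
  proof
    show "T \<subseteq> {-r..r}"
      using r(2) symT by force
    have "convex T"
    proof -
      have "T = (\<lambda>t. t *\<^sub>R e) -` K" by (auto simp: T_def)
      then show ?thesis
        using cvx by (simp add: convex_linear_vimage linear_scaleR_left)
    qed
    moreover have "{-r..r} = closed_segment (-r) r"
      using rpos by (simp add: closed_segment_eq_real_ivl)
    ultimately show "{-r..r} \<subseteq> T"
      using r(1) symT closed_segment_subset by metis
  qed
  then show thesis
    using that rpos by (simp add: T_def)
qed

lemma section_line_length:
  assumes K: "K \<in> sym_convex_bodies" and w: "w \<noteq> 0" "orthogonal w e" "norm e = 1"
  obtains r where "r > 0" "{t::real. t *\<^sub>R e \<in> K} = {-r..r}"
    "line_length w (K \<inter> {w}\<^sup>\<bottom>) = 2 * r"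
proof -
  obtain r where r: "r > 0" "{t::real. t *\<^sub>R e \<in> K} = {-r..r}"
    using sym_convex_body_radius[OF K w(3)] .
  have "{t::real. t *\<^sub>R e \<in> K \<inter> {w}\<^sup>\<bottom>} = {-r..r}"
    using r(2) w(2) by (auto simp: orthogonal_comp_def orthogonal_def)
  then have "line_length w (K \<inter> {w}\<^sup>\<bottom>) = 2 * r"
    using line_length_unit[OF w] r(1) by simp
  then show thesis using r that by blast
qed

lemma section_ratio_minimum:
  assumes K: "K \<in> sym_convex_bodies"
  obtains w1 w2 where "orthogonal_basis w1 w2"
    "\<And>v1 v2. orthogonal_basis v1 v2 \<Longrightarrow> section_ratio K w1 w2 \<le> section_ratio K v1 v2"
proof -
  have cpt: "compact K"
    using K by (auto simp: sym_convex_bodies_def convex_body_def)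
  define C where "C = (K \<times> K) \<inter> {z. fst z \<bullet> snd z = 0}"
  have clos: "closed {z::(real^2) \<times> (real^2). fst z \<bullet> snd z = 0}"
    by (intro closed_Collect_eq continuous_intros)
  have "compact C"
    unfolding C_def by (intro compact_Int_closed compact_Times cpt clos)
  moreover have radii: "\<exists>r1 r2 x. r1 > 0 \<and> r2 > 0 \<and> x \<in> C \<and> norm (fst x) = r1 \<and> norm (snd x) = r2 \<and>
      line_length v1 (K \<inter> {v1}\<^sup>\<bottom>) = 2 * r1 \<and> line_length v2 (K \<inter> {v2}\<^sup>\<bottom>) = 2 * r2"
    if "orthogonal_basis v1 v2" for v1 v2
  proof -
    have v: "v1 \<noteq> 0" "v2 \<noteq> 0" "v1 \<bullet> v2 = 0"
      using that by (auto simp: orthogonal_basis_iff orthogonal_def)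
    define e1 where "e1 = rot v1 /\<^sub>R norm v1"
    define e2 where "e2 = rot v2 /\<^sub>R norm v2"
    have e: "norm e1 = 1" "norm e2 = 1" "orthogonal v1 e1" "orthogonal v2 e2" "e1 \<bullet> e2 = 0"
      using v by (auto simp: e1_def e2_def orthogonal_def)
    obtain r1 where r1: "r1 > 0" "{t::real. t *\<^sub>R e1 \<in> K} = {-r1..r1}"
      "line_length v1 (K \<inter> {v1}\<^sup>\<bottom>) = 2 * r1"
      using section_line_length[OF K v(1) e(3) e(1)] .
    obtain r2 where r2: "r2 > 0" "{t::real. t *\<^sub>R e2 \<in> K} = {-r2..r2}"
      "line_length v2 (K \<inter> {v2}\<^sup>\<bottom>) = 2 * r2"
      using section_line_length[OF K v(2) e(4) e(2)] .
    have "r1 \<in> {t::real. t *\<^sub>R e1 \<in> K}" "r2 \<in> {t::real. t *\<^sub>R e2 \<in> K}"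
      unfolding r1(2) r2(2) using r1(1) r2(1) by auto
    then have "(r1 *\<^sub>R e1, r2 *\<^sub>R e2) \<in> C"
      using e by (auto simp: C_def)
    then show ?thesis
      using r1 r2 e by (intro exI[of _ r1] exI[of _ r2] exI[of _ "(r1 *\<^sub>R e1, r2 *\<^sub>R e2)"]) auto
  qed
  have b0: "orthogonal_basis (axis 1 1) (axis 2 1)"
    by (auto simp: orthogonal_basis_iff orthogonal_def inner_2 axis_def vec_eq_iff)
  obtain x0 where x0: "x0 \<in> C" "norm (fst x0) > 0" "norm (snd x0) > 0"
    using radii[OF b0] by auto
  moreover have "continuous_on C (\<lambda>z. norm (fst z) * norm (snd z))"
    by (intro continuous_intros)
  ultimately obtain z where z: "z \<in> C"
    "\<And>x. x \<in> C \<Longrightarrow> norm (fst x) * norm (snd x) \<le> norm (fst z) * norm (snd z)"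
    using continuous_attains_sup[of C "\<lambda>z. norm (fst z) * norm (snd z)"] by blast
  obtain p q where pq: "z = (p, q)" by (cases z)
  have "0 < norm (fst x0) * norm (snd x0)"
    using x0 by simp
  then have "norm p * norm q > 0"
    using z(2)[OF x0(1)] pq by simp
  then have nz: "p \<noteq> 0" "q \<noteq> 0" by auto
  have pqK: "p \<in> K" "q \<in> K" "p \<bullet> q = 0"
    using z(1) pq by (auto simp: C_def)
  have ge: "line_length (rot y) (K \<inter> {rot y}\<^sup>\<bottom>) \<ge> 2 * norm y" if "y \<in> K" "y \<noteq> 0" for y
  proof -
    have "rot y \<noteq> 0" using that by simp
    moreover have "orthogonal (rot y) (y /\<^sub>R norm y)"
      by (simp add: orthogonal_def inner_commute)
    moreover have "norm (y /\<^sub>R norm y) = 1" using that by simp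
    ultimately obtain r where r: "r > 0" "{t::real. t *\<^sub>R (y /\<^sub>R norm y) \<in> K} = {-r..r}"
      "line_length (rot y) (K \<inter> {rot y}\<^sup>\<bottom>) = 2 * r"
      using section_line_length[OF K] by metis
    have "norm y \<in> {t::real. t *\<^sub>R (y /\<^sub>R norm y) \<in> K}"
      using that by simp
    then show ?thesis using r by auto
  qed
  have "orthogonal_basis (rot p) (rot q)"
    using nz pqK by (auto simp: orthogonal_basis_iff orthogonal_def)
  moreover have "section_ratio K (rot p) (rot q) \<le> section_ratio K v1 v2"
    if v: "orthogonal_basis v1 v2" for v1 v2
  proof -
    obtain r1 r2 x where r: "r1 > 0" "r2 > 0" "x \<in> C" "norm (fst x) = r1" "norm (snd x) = r2"
      "line_length v1 (K \<inter> {v1}\<^sup>\<bottom>) = 2 * r1" "line_length v2 (K \<inter> {v2}\<^sup>\<bottom>) = 2 * r2"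
      using radii[OF v] by blast
    have pos: "line_length (rot p) (K \<inter> {rot p}\<^sup>\<bottom>) > 0" "line_length (rot q) (K \<inter> {rot q}\<^sup>\<bottom>) > 0"
      using ge[OF pqK(1) nz(1)] ge[OF pqK(2) nz(2)] nz by (smt (verit) zero_less_norm_iff)+
    have "r1 * r2 \<le> norm p * norm q"
      using z(2)[OF r(3)] r pq by simp
    then have "(2 * r1) * (2 * r2) \<le> (2 * norm p) * (2 * norm q)"
      by simp
    also have "\<dots> \<le> line_length (rot p) (K \<inter> {rot p}\<^sup>\<bottom>) * line_length (rot q) (K \<inter> {rot q}\<^sup>\<bottom>)"
      by (intro mult_mono) (use ge[OF pqK(1) nz(1)] ge[OF pqK(2) nz(2)] in
        \<open>auto simp: line_length_def\<close>)
    finally show ?thesis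
      unfolding section_ratio_def r(6,7) using r(1,2)
      by (intro divide_left_mono mult_pos_pos pos) auto
  qed
  ultimately show thesis using that by blast
qed

lemma Lambda_tilde_attained:
  assumes "K \<in> sym_convex_bodies"
  shows "\<exists>w1 w2. orthogonal_basis w1 w2 \<and> Lambda_tilde K = section_ratio K w1 w2"
    (is "?P (Lambda_tilde K)")
proof -
  obtain w1 w2 where w: "orthogonal_basis w1 w2"
    "\<And>v1 v2. orthogonal_basis v1 v2 \<Longrightarrow> section_ratio K w1 w2 \<le> section_ratio K v1 v2"
    using section_ratio_minimum[OF assms] by blast
  have "Lambda_tilde K = section_ratio K w1 w2"
    unfolding Lambda_tilde_def by (rule Least_equality) (use w in auto)
  then show ?thesis using w by blast
qed

lemma Lambda_tilde_le:
  assumes "K \<in> sym_convex_bodies" "orthogonal_basis v1 v2"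
  shows "Lambda_tilde K \<le> section_ratio K v1 v2"
proof -
  obtain w1 w2 where w: "orthogonal_basis w1 w2"
    "\<And>v1 v2. orthogonal_basis v1 v2 \<Longrightarrow> section_ratio K w1 w2 \<le> section_ratio K v1 v2"
    using section_ratio_minimum[OF assms(1)] by blast
  have "Lambda_tilde K = section_ratio K w1 w2"
    unfolding Lambda_tilde_def by (rule Least_equality) (use w in auto)
  then show ?thesis using w(2)[OF assms(2)] by simp
qed

end

theory Submission
  imports Defs
begin

text \<open>
  The value of \<open>K\<close> is the least ratio of its area to a product of two section lengths.  That product is
  \<open>4 |p| |q|\<close>, where \<open>p\<close> and \<open>q\<close> are boundary points of \<open>K\<close> in perpendicular directions.

  \<^emph>\<open>Every body has a value below one.\<close>  Let \<open>p\<close> be a longest vector of \<open>K\<close> and let \<open>q\<close> be the last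
  point of \<open>K\<close> in a perpendicular direction.  Since \<open>K\<close> lies in the disc of radius \<open>|p|\<close>, it lies in
  the strip \<open>|x \<bullet> p| \<le> |p|\<^sup>2\<close>; since \<open>K\<close> is symmetric and convex, it also lies in the strip between
  parallel supporting lines at \<open>q\<close> and \<open>-q\<close>.  These two strips meet in a parallelogram
  (\<open>subset_parallelogram\<close>) with one pair of sides parallel to \<open>q\<close> and of length \<open>2 |q|\<close>, at distance
  \<open>2 |p|\<close> from each other, so its area is \<open>4 |p| |q|\<close>.  The inequality is strict, because
  the four corners are \<open>\<plusminus>p + c q\<close> with coefficients \<open>c\<close> that differ by two on each side, so some
  corner has \<open>c \<noteq> 0\<close> and lies outside the disc together with a piece of the parallelogram of
  positive area (\<open>measure_shear_disc_less\<close>).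

  \<^emph>\<open>One is approached.\<close>  The rectangle \<open>[-L, L] \<times> [-1, 1]\<close> has area \<open>4 L\<close>, and perpendicular vectors
  in it satisfy \<open>|p| |q| \<le> L + 1/L\<close> (\<open>rect_perpendicular_product\<close>), with equality for the diagonal.
  Its value is thus at least \<open>L / (L + 1/L)\<close>, which tends to one as \<open>L\<close> grows.
\<close>

section \<open>Perpendicular vectors and central chords in the plane\<close>

lemma orthogonal_imp_multiple_rot:
  fixes p q :: "real^2"
  assumes "p \<bullet> q = 0" "p \<noteq> 0"
  obtains s where "q = s *\<^sub>R rot p"
proof -
  define s where "s = (q \<bullet> rot p) / (p \<bullet> p)"
  define d where "d = q - s *\<^sub>R rot p"
  have "p \<bullet> d = 0" "rot p \<bullet> d = 0"
    using assms by (simp_all add: d_def inner_diff_right s_def inner_commute)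
  moreover have "(p \<bullet> p) * (d \<bullet> d) = (p \<bullet> d)\<^sup>2 + (rot p \<bullet> d)\<^sup>2"
    by (simp add: inner_2 power2_eq_square algebra_simps)
  ultimately have "d = 0" using assms(2) by simp
  then have "q = s *\<^sub>R rot p" by (simp add: d_def)
  then show thesis by (rule that)
qed

text \<open>
  The chord of \<open>K\<close> along \<open>p\<close>, measured in multiples of \<open>p\<close> rather than of the unit vector, so
  that later the position of \<open>p\<close> itself relative to the end of the chord can be read off.
\<close>

lemma chord_along:
  assumes K: "K \<in> sym_convex_bodies" and p: "p \<noteq> 0"
  obtains r where "r > 0" "{t::real. t *\<^sub>R p \<in> K} = {-r..r}"
    "line_length (rot p) (K \<inter> {rot p}\<^sup>\<bottom>) = 2 * r * norm p"
proof -
  have "orthogonal (rot p) (p /\<^sub>R norm p)" "norm (p /\<^sub>R norm p) = 1" "rot p \<noteq> 0"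
    using p by (simp_all add: orthogonal_def inner_commute)
  then obtain r where r: "r > 0" "{t::real. t *\<^sub>R (p /\<^sub>R norm p) \<in> K} = {-r..r}"
    "line_length (rot p) (K \<inter> {rot p}\<^sup>\<bottom>) = 2 * r"
    using section_line_length[OF K] by metis
  have "{t::real. t *\<^sub>R p \<in> K} = {-(r / norm p)..r / norm p}"
  proof -
    have "t *\<^sub>R p \<in> K \<longleftrightarrow> t * norm p \<in> {-r..r}" for t
      unfolding r(2)[symmetric] using p by (simp add: mult.assoc)
    then show ?thesis
      using p by (intro set_eqI) (simp add: pos_le_divide_eq pos_minus_divide_le_eq)
  qed
  moreover have "r / norm p > 0" "2 * r = 2 * (r / norm p) * norm p"
    using r(1) p by simp_all
  ultimately show thesis using that[of "r / norm p"] r(3) by presburger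
qed

lemma chord_endpoint:
  assumes K: "K \<in> sym_convex_bodies" and v: "v \<noteq> 0"
  obtains t where "t \<noteq> 0" "t *\<^sub>R rot v \<in> K"
    "line_length v (K \<inter> {v}\<^sup>\<bottom>) = 2 * norm (t *\<^sub>R rot v)"
proof -
  have "orthogonal v (rot v /\<^sub>R norm v)" "norm (rot v /\<^sub>R norm v) = 1"
    using v by (simp_all add: orthogonal_def)
  then obtain r where r: "r > 0" "{t::real. t *\<^sub>R (rot v /\<^sub>R norm v) \<in> K} = {-r..r}"
    "line_length v (K \<inter> {v}\<^sup>\<bottom>) = 2 * r"
    using section_line_length[OF K v] by metis
  have "r \<in> {t::real. t *\<^sub>R (rot v /\<^sub>R norm v) \<in> K}"
    unfolding r(2) using r(1) by simp
  then show thesis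
    using r v that[of "r / norm v"] by (simp add: divide_inverse)
qed

section \<open>A circumscribed parallelogram\<close>

text \<open>
  A supporting line at a boundary point \<open>q\<close>, with normal \<open>n\<close>.  It is obtained by separating \<open>K\<close>
  from the part of the ray through \<open>q\<close> beyond \<open>q\<close>; symmetry of \<open>K\<close> turns the half-plane into
  a strip.
\<close>

lemma supporting_strip:
  assumes K: "K \<in> sym_convex_bodies" and q: "q \<noteq> 0" "q \<in> K" "\<And>t. t > 1 \<Longrightarrow> t *\<^sub>R q \<notin> K"
  obtains n where "q \<bullet> n > 0" "\<And>x. x \<in> K \<Longrightarrow> \<bar>x \<bullet> n\<bar> \<le> q \<bullet> n"
proof -
  have cvx: "convex K" and sym: "\<And>x. x \<in> K \<Longrightarrow> - x \<in> K"
    using K by (auto simp: sym_convex_bodies_def convex_body_def)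
  define T where "T = (\<lambda>t::real. t *\<^sub>R q) ` {1<..}"
  have "convex T"
    unfolding T_def by (intro convex_linear_image linear_scaleR_left convex_real_interval)
  moreover have "T \<noteq> {}" by (simp add: T_def)
  moreover have "K \<inter> T = {}" using q(3) by (auto simp: T_def)
  ultimately obtain n b where n: "n \<noteq> 0" "\<forall>x\<in>K. n \<bullet> x \<le> b" "\<forall>x\<in>T. n \<bullet> x \<ge> b"
    using separating_hyperplane_sets[of K T] cvx q by auto
  have up: "b \<le> t * (q \<bullet> n)" if "t > 1" for t
    using n(3) that by (auto simp: T_def inner_commute)
  \<comment> \<open>Letting the point beyond \<open>q\<close> approach \<open>q\<close> shows that the line passes through \<open>q\<close>.\<close>
  have "b \<le> q \<bullet> n"
  proof (rule tendsto_lowerbound[where F = "at_right 1"])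
    show "((\<lambda>t. t * (q \<bullet> n)) \<longlongrightarrow> q \<bullet> n) (at_right 1)"
      by (auto intro!: tendsto_eq_intros)
    show "\<forall>\<^sub>F t in at_right 1. b \<le> t * (q \<bullet> n)"
      using up by (auto simp: eventually_at_right_field intro: exI[of _ 2])
  qed simp
  then have le: "x \<bullet> n \<le> q \<bullet> n" if "x \<in> K" for x
    using n(2) that by (force simp: inner_commute)
  \<comment> \<open>\<open>K\<close> contains a positive multiple of \<open>n\<close>, so the strip has positive width.\<close>
  obtain r where r: "r > 0" "{t::real. t *\<^sub>R n \<in> K} = {-r..r}"
    using chord_along[OF K n(1)] by metis
  moreover have "r \<in> {-r..r}" using r(1) by simp
  ultimately have "r *\<^sub>R n \<in> K" by blast
  then have "0 < q \<bullet> n" using le[of "r *\<^sub>R n"] r(1) n(1)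
    by (smt (verit) inner_gt_zero_iff inner_scaleR_left mult_pos_pos)
  moreover have "\<bar>x \<bullet> n\<bar> \<le> q \<bullet> n" if "x \<in> K" for x
    using le[OF that] le[OF sym[OF that]] by simp
  ultimately show thesis using that by blast
qed

text \<open>
  The linear map with columns \<open>u\<close> and \<open>q\<close>.  For \<open>u = p + m q\<close> with \<open>p\<close> perpendicular to \<open>q\<close> it is
  a shear in the coordinates given by \<open>p\<close> and \<open>q\<close>, and it maps the square \<open>[-1, 1]\<^sup>2\<close> onto a parallelogram
  with two sides on the lines \<open>x \<bullet> p = \<plusminus>|p|\<^sup>2\<close>.
\<close>

definition shear :: "real^2 \<Rightarrow> real^2 \<Rightarrow> real^2 \<Rightarrow> real^2" where
  "shear u q z = z$1 *\<^sub>R u + z$2 *\<^sub>R q"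

lemma linear_shear: "linear (shear u q)"
  by (rule linearI) (simp_all add: shear_def algebra_simps)

text \<open>The determinant does not depend on \<open>m\<close>: a shear preserves area.\<close>

lemma abs_det_shear:
  assumes "p \<bullet> q = 0"
  shows "\<bar>det (matrix (shear (p + m *\<^sub>R q) q))\<bar> = norm p * norm q"
proof -
  have "det (matrix (shear (p + m *\<^sub>R q) q)) = p \<bullet> rot q * (-1)"
    by (simp add: det_2 matrix_def shear_def axis_def inner_2 algebra_simps)
  moreover have "(p \<bullet> rot q)\<^sup>2 + (p \<bullet> q)\<^sup>2 = (norm p * norm q)\<^sup>2"
    unfolding power_mult_distrib power2_norm_eq_inner inner_2
    by (simp add: power2_eq_square algebra_simps)
  then have "\<bar>p \<bullet> rot q\<bar> = norm p * norm q"
    using assms by (simp add: real_sqrt_unique flip: real_sqrt_abs)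
  ultimately show ?thesis by simp
qed

text \<open>
  The square \<open>rect 1\<close> parametrises parallelograms by \<open>shear\<close>; for large \<open>L\<close> these are the bodies
  whose value approaches one.
\<close>

definition rect :: "real \<Rightarrow> (real^2) set" where
  "rect L = cbox (vector [-L, -1]) (vector [L, 1])"

lemma mem_rect: "x \<in> rect L \<longleftrightarrow> \<bar>x$1\<bar> \<le> L \<and> \<bar>x$2\<bar> \<le> 1"
  by (auto simp: rect_def mem_box_cart forall_2)

lemma rect_sym_convex_body:
  assumes "L > 0"
  shows "rect L \<in> sym_convex_bodies"
proof -
  have "uminus ` rect L = rect L"
    by (force simp: mem_rect intro: image_eqI[of _ uminus "- x" for x])
  moreover have "0 \<in> box (vector [-L, -1]) (vector [L, 1] :: real^2)"
    using assms by (auto simp: mem_box_cart forall_2)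
  ultimately show ?thesis
    unfolding sym_convex_bodies_def convex_body_def by (auto simp: rect_def interior_cbox)
qed

lemma measure_rect:
  assumes "L > 0"
  shows "measure lebesgue (rect L) = 4 * L"
proof -
  have "0 \<in> rect L" using assms by (simp add: mem_rect)
  then have "rect L \<noteq> {}" by blast
  then show ?thesis
    unfolding rect_def by (simp add: content_cbox_cart UNIV_2)
qed

text \<open>
  The corners over \<open>(1, 1)\<close> and \<open>(1, -1)\<close> are \<open>p + (m + 1) q\<close> and \<open>p + (m - 1) q\<close>.  At least one
  of them is longer than \<open>p\<close>, so the disc of radius \<open>|p|\<close> misses an open piece of the
  parallelogram.
\<close>

lemma measure_shear_disc_less:
  fixes p q :: "real^2" and m :: real
  assumes "p \<bullet> q = 0" "q \<noteq> 0"
  defines "f \<equiv> shear (p + m *\<^sub>R q) q"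
  defines "C \<equiv> rect 1 \<inter> {z. norm (f z) \<le> norm p}"
  shows "compact C" "measure lebesgue C < 4"
proof -
  have lin: "linear f" by (simp add: f_def linear_shear)
  show clC: "compact C"
    unfolding C_def rect_def
    by (intro compact_Int_closed compact_cbox closed_Collect_le continuous_intros
        linear_continuous_on linear_conv_bounded_linear[THEN iffD1] lin)
  define U where "U = interior (rect 1) \<inter> {z. norm p < norm (f z)}"
  have "open U" unfolding U_def
    by (intro open_Int open_interior open_Collect_less continuous_intros
        linear_continuous_on linear_conv_bounded_linear[THEN iffD1] lin)
  \<comment> \<open>A sign that cannot cancel \<open>m\<close>, so that the corner over \<open>(1, \<sigma>)\<close> is not \<open>p\<close> itself.\<close>
  define \<sigma> :: real where "\<sigma> = (if m \<ge> 0 then 1 else -1)"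
  define c :: "real^2" where "c = vector [1, \<sigma>]"
  have fc: "f c = p + (m + \<sigma>) *\<^sub>R q" by (simp add: f_def shear_def c_def algebra_simps)
  have "(norm (f c))\<^sup>2 = (norm p)\<^sup>2 + ((m + \<sigma>) * norm q)\<^sup>2"
    using assms(1) unfolding fc power2_norm_eq_inner power_mult_distrib
    by (simp add: inner_add_left inner_add_right inner_commute power2_eq_square)
  moreover have "m + \<sigma> \<noteq> 0" by (auto simp: \<sigma>_def)
  ultimately have "(norm p)\<^sup>2 < (norm (f c))\<^sup>2" using assms(2) by simp
  then have big: "norm p < norm (f c)" by (simp add: power2_less_imp_less)
  \<comment> \<open>Scaled down slightly, \<open>c\<close> enters the interior of the square and its image stays longer than \<open>p\<close>.\<close>
  then obtain x where x: "norm p / norm (f c) < x" "x < 1"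
    using dense[of "norm p / norm (f c)" 1] by (auto simp: divide_less_eq_1)
  have xp: "x > 0" using x(1) by (meson divide_nonneg_nonneg norm_ge_zero order_le_less_trans)
  have "norm (f (x *\<^sub>R c)) = x * norm (f c)"
    using xp by (simp add: linear_scale[OF lin])
  then have "norm p < norm (f (x *\<^sub>R c))"
    using x(1) big by (metis divide_less_eq norm_ge_zero order_le_less_trans)
  then have "x *\<^sub>R c \<in> U"
    using x xp by (auto simp: U_def rect_def interior_cbox mem_box_cart forall_2 c_def \<sigma>_def)
  then have "\<not> negligible U" using open_not_negligible[OF \<open>open U\<close>] by blast
  moreover have Um: "U \<in> lmeasurable"
  proof (rule lmeasurable_open[OF _ \<open>open U\<close>])
    show "bounded U"
      by (rule bounded_subset[of "rect 1"])
        (use interior_subset[of "rect 1"] in \<open>auto simp: U_def rect_def\<close>)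
  qed
  ultimately have "measure lebesgue U > 0"
    using negligible_iff_measure[of U] by (simp add: zero_less_measure_iff measure_nonneg less_le)
  moreover have "measure lebesgue C + measure lebesgue U = measure lebesgue (C \<union> U)"
  proof -
    have "C \<inter> U = {}" by (auto simp: C_def U_def)
    then show ?thesis
      using measure_Un3[of C lebesgue U] clC Um by (simp add: lmeasurable_compact)
  qed
  moreover have "measure lebesgue (C \<union> U) \<le> measure lebesgue (rect 1)"
  proof (rule measure_mono_fmeasurable)
    show "C \<union> U \<subseteq> rect 1"
      using interior_subset[of "rect 1"] by (auto simp: C_def U_def)
    show "C \<union> U \<in> sets lebesgue"
      using lmeasurable_compact[OF clC] Um by auto
  qed (simp add: rect_def)
  ultimately show "measure lebesgue C < 4" using measure_rect[of 1] by simp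
qed

text \<open>
  In the orthogonal coordinates \<open>v = a p + b q\<close>, the disc gives \<open>|a| \<le> 1\<close>.  The slope
  \<open>m\<close> is chosen such that \<open>p + m q\<close> is perpendicular to \<open>n\<close>; then \<open>v \<bullet> n = (b - a m) (q \<bullet> n)\<close>, and
  the strip gives \<open>|b - a m| \<le> 1\<close>.
\<close>

lemma subset_parallelogram:
  fixes p q n :: "real^2"
  assumes longest: "\<And>x. x \<in> K \<Longrightarrow> norm x \<le> norm p" and p0: "p \<noteq> 0" and pq: "p \<bullet> q = 0"
    and n: "q \<bullet> n > 0" and strip: "\<And>x. x \<in> K \<Longrightarrow> \<bar>x \<bullet> n\<bar> \<le> q \<bullet> n"
  defines "m \<equiv> - (p \<bullet> n) / (q \<bullet> n)"
  defines "f \<equiv> shear (p + m *\<^sub>R q) q"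
  shows "K \<subseteq> f ` (rect 1 \<inter> {z. norm (f z) \<le> norm p})"
proof
  fix v assume v: "v \<in> K"
  define a where "a = (v \<bullet> p) / (p \<bullet> p)"
  have "p \<bullet> (v - a *\<^sub>R p) = 0"
    using p0 by (simp add: a_def inner_diff_right inner_commute)
  then obtain c where c: "v - a *\<^sub>R p = c *\<^sub>R rot p"
    using orthogonal_imp_multiple_rot p0 by blast
  obtain d where d: "q = d *\<^sub>R rot p"
    using orthogonal_imp_multiple_rot[OF pq p0] by blast
  have "d \<noteq> 0" using n d by auto
  define b where "b = c / d"
  have vab: "v = a *\<^sub>R p + b *\<^sub>R q"
    using c \<open>d \<noteq> 0\<close> by (simp add: b_def d algebra_simps)
  have "\<bar>v \<bullet> p\<bar> \<le> norm v * norm p" by (rule Cauchy_Schwarz_ineq2)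
  also have "\<dots> \<le> p \<bullet> p" using longest[OF v]
    by (simp add: dot_square_norm power2_eq_square mult_right_mono)
  finally have a: "\<bar>a\<bar> \<le> 1" using p0 by (simp add: a_def abs_divide divide_le_eq_1)
  have "v \<bullet> n = (b - a * m) * (q \<bullet> n)"
    using n by (simp add: vab m_def inner_add_left field_simps)
  then have "\<bar>b - a * m\<bar> * (q \<bullet> n) \<le> 1 * (q \<bullet> n)"
    using strip[OF v] n by (simp add: abs_mult)
  then have b: "\<bar>b - a * m\<bar> \<le> 1" using n mult_le_cancel_right_pos by blast
  define z :: "real^2" where "z = vector [a, b - a * m]"
  have fz: "f z = v" by (simp add: f_def shear_def z_def vab algebra_simps)
  moreover have "z \<in> rect 1 \<inter> {z. norm (f z) \<le> norm p}"
    using a b longest[OF v] fz by (auto simp: mem_rect z_def)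
  ultimately show "v \<in> f ` (rect 1 \<inter> {z. norm (f z) \<le> norm p})" by blast
qed

lemma area_less_longest_times_perpendicular:
  assumes K: "K \<in> sym_convex_bodies"
    and longest: "\<And>x. x \<in> K \<Longrightarrow> norm x \<le> norm p" and p0: "p \<noteq> 0" and pq: "p \<bullet> q = 0"
    and q: "q \<noteq> 0" "q \<in> K" "\<And>t. t > 1 \<Longrightarrow> t *\<^sub>R q \<notin> K"
  shows "measure lebesgue K < 4 * (norm p * norm q)"
proof -
  have cpt: "compact K"
    using K by (auto simp: sym_convex_bodies_def convex_body_def)
  obtain n where n: "q \<bullet> n > 0" "\<And>x. x \<in> K \<Longrightarrow> \<bar>x \<bullet> n\<bar> \<le> q \<bullet> n"
    using supporting_strip[OF K q] by blast
  define m where "m = - (p \<bullet> n) / (q \<bullet> n)"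
  define f where "f = shear (p + m *\<^sub>R q) q"
  define C where "C = rect 1 \<inter> {z. norm (f z) \<le> norm p}"
  have lin: "linear f" by (simp add: f_def linear_shear)
  have C: "compact C" "measure lebesgue C < 4"
    unfolding C_def f_def by (rule measure_shear_disc_less[OF pq q(1)])+
  have "K \<subseteq> f ` C"
    unfolding C_def f_def m_def by (rule subset_parallelogram[OF longest p0 pq n])
  then have "measure lebesgue K \<le> measure lebesgue (f ` C)"
    using fmeasurableD[OF lmeasurable_compact[OF cpt]] C(1)
      measurable_linear_image[OF lin lmeasurable_compact]
    by (intro measure_mono_fmeasurable) auto
  also have "\<dots> = norm p * norm q * measure lebesgue C"
    using measure_linear_image[OF lin lmeasurable_compact[OF C(1)]] abs_det_shear[OF pq]
    by (simp add: f_def)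
  also have "\<dots> < norm p * norm q * 4"
    using C(2) p0 q(1) by (intro mult_strict_left_mono) auto
  finally show ?thesis by simp
qed

text \<open>
  The chord along the longest vector \<open>p\<close> has length at least \<open>2 |p|\<close>, and the chord along \<open>rot p\<close>
  ends at \<open>q\<close>, so already the basis of normals to these two chords gives a ratio below one.
\<close>

lemma Lambda_tilde_less_1:
  assumes K: "K \<in> sym_convex_bodies"
  shows "Lambda_tilde K < 1"
proof -
  have cpt: "compact K" and int: "interior K \<noteq> {}"
    using K by (auto simp: sym_convex_bodies_def convex_body_def)
  obtain p where p: "p \<in> K" "\<And>x. x \<in> K \<Longrightarrow> norm x \<le> norm p"
    using continuous_attains_sup[of K norm] cpt interior_empty int continuous_on_norm_id by metis
  have p0: "p \<noteq> 0"
  proof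
    assume "p = 0"
    then have "K \<subseteq> {0}" using p by auto
    then show False using int interior_mono[of K "{0}"] by auto
  qed
  obtain r where r: "r > 0" "{t::real. t *\<^sub>R rot p \<in> K} = {-r..r}"
    "line_length (rot (rot p)) (K \<inter> {rot (rot p)}\<^sup>\<bottom>) = 2 * r * norm (rot p)"
    using chord_along[OF K, of "rot p"] p0 by (metis rot_eq_0_iff)
  define q where "q = r *\<^sub>R rot p"
  obtain s where s: "s > 0" "{t::real. t *\<^sub>R p \<in> K} = {-s..s}"
    "line_length (rot p) (K \<inter> {rot p}\<^sup>\<bottom>) = 2 * s * norm p"
    using chord_along[OF K p0] by metis
  have "1 \<in> {t::real. t *\<^sub>R p \<in> K}" using p by simp
  then have s1: "s \<ge> 1" unfolding s(2) by simp
  have t: "t *\<^sub>R rot p \<in> K \<longleftrightarrow> t \<in> {-r..r}" for t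
    using r(2) by blast
  have q: "q \<noteq> 0" "q \<in> K" "p \<bullet> q = 0" "\<And>t. t > 1 \<Longrightarrow> t *\<^sub>R q \<notin> K"
    using r(1) p0 by (auto simp: q_def t)
  have "measure lebesgue K < 4 * (norm p * norm q)"
    by (rule area_less_longest_times_perpendicular[OF K p(2) p0 q(3,1,2,4)])
  also have "\<dots> \<le> (2 * s * norm p) * (2 * r * norm (rot p))"
    using s1 r(1) mult_right_mono[OF s1, of "norm p * norm q"] by (simp add: q_def mult_ac)
  finally have "section_ratio K (rot p) (rot (rot p)) < 1"
    using s(1) r(1) p0 unfolding section_ratio_def s(3) r(3)
    by (subst divide_less_eq_1_pos) auto
  moreover have "orthogonal_basis (rot p) (rot (rot p))"
    using p0 by (auto simp: orthogonal_basis_iff orthogonal_def inner_commute)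
  ultimately show ?thesis using Lambda_tilde_le[OF K] by fastforce
qed

section \<open>Long rectangles\<close>

text \<open>
  Here \<open>(a, b)\<close> and \<open>s (-b, a)\<close> are perpendicular vectors of the rectangle, the first one closer
  to the long axis.  For \<open>|a| \<ge> 1\<close> the bounds \<open>|s a| \<le> 1\<close> and \<open>|b| \<le> 1\<close> give \<open>|a| + 1/|a|\<close>, which is
  increasing in \<open>|a| \<le> L\<close>; for \<open>|a| < 1\<close> the bound \<open>|b| \<le> |a|\<close> gives at most \<open>2\<close>.
\<close>

lemma perpendicular_product_bound:
  fixes a b s L :: real
  assumes "L \<ge> 1" "\<bar>a\<bar> \<le> L" "\<bar>b\<bar> \<le> 1" "\<bar>s * a\<bar> \<le> 1" "\<bar>b\<bar> \<le> \<bar>a\<bar>"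
  shows "\<bar>s\<bar> * (a\<^sup>2 + b\<^sup>2) \<le> L + 1 / L"
proof (cases "a = 0")
  case False
  \<comment> \<open>Both ranges of \<open>|a|\<close> give the bound \<open>x + 1/x\<close>.\<close>
  define x where "x = max 1 \<bar>a\<bar>"
  have x: "1 \<le> x" "x \<le> L" using assms(1,2) by (simp_all add: x_def)
  have L2: "x + 1 / x \<le> L + 1 / L"
  proof -
    have "L + 1 / L - (x + 1 / x) = (L - x) * (L * x - 1) / (L * x)"
      using x by (simp add: field_simps)
    moreover have "L * x \<ge> 1" using x assms(1) by (metis mult_mono' mult_1 zero_le_one order_trans)
    ultimately have "L + 1 / L - (x + 1 / x) \<ge> 0" using x by simp
    then show ?thesis by simp
  qed
  have "\<bar>s\<bar> * (a\<^sup>2 + b\<^sup>2) = \<bar>s * a\<bar> * (\<bar>a\<bar> + b\<^sup>2 / \<bar>a\<bar>)"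
    using False by (simp add: abs_mult field_simps power2_eq_square)
  also have "\<dots> \<le> \<bar>a\<bar> + b\<^sup>2 / \<bar>a\<bar>"
    using mult_right_mono[OF assms(4), of "\<bar>a\<bar> + b\<^sup>2 / \<bar>a\<bar>"] by simp
  also have "\<dots> \<le> x + 1 / x"
  proof (cases "\<bar>a\<bar> \<ge> 1")
    case True
    have "b\<^sup>2 \<le> 1" using assms(3) by (simp add: abs_square_le_1)
    then show ?thesis using True by (simp add: x_def divide_right_mono)
  next
    case False
    have "b\<^sup>2 \<le> a\<^sup>2" using assms(5) by (simp add: abs_le_square_iff)
    then have "b\<^sup>2 / \<bar>a\<bar> \<le> \<bar>a\<bar>" using \<open>a \<noteq> 0\<close> by (simp add: field_simps power2_eq_square)
    then show ?thesis using False by (simp add: x_def)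
  qed
  finally show ?thesis using L2 by simp
qed (use assms in auto)

lemma rect_perpendicular_product_ordered:
  assumes "L \<ge> 1" "p \<in> rect L" "q \<in> rect L" "p \<bullet> q = 0" "\<bar>p$2\<bar> \<le> \<bar>p$1\<bar>"
  shows "norm p * norm q \<le> L + 1 / L"
proof (cases "p = 0")
  case False
  then obtain s where s: "q = s *\<^sub>R rot p" using orthogonal_imp_multiple_rot assms(4) by blast
  have "norm p * norm q = \<bar>s\<bar> * ((p$1)\<^sup>2 + (p$2)\<^sup>2)"
    using power2_norm_eq_inner[of p] by (simp add: s inner_2 power2_eq_square)
  also have "\<dots> \<le> L + 1 / L"
    using assms by (intro perpendicular_product_bound) (auto simp: mem_rect s)
  finally show ?thesis .
qed (use assms in simp)

text \<open>
  Of two perpendicular vectors, one makes an angle of at most \<open>45\<close> degrees with the long axis, and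
  the claim is symmetric in them.
\<close>

lemma rect_perpendicular_product:
  assumes "L \<ge> 1" "p \<in> rect L" "q \<in> rect L" "p \<bullet> q = 0"
  shows "norm p * norm q \<le> L + 1 / L"
proof (cases "\<bar>p$2\<bar> \<le> \<bar>p$1\<bar>")
  case True then show ?thesis using rect_perpendicular_product_ordered assms by blast
next
  case False
  then have "p \<noteq> 0" by auto
  then obtain s where s: "q = s *\<^sub>R rot p" using orthogonal_imp_multiple_rot assms(4) by blast
  have "\<bar>q$2\<bar> \<le> \<bar>q$1\<bar>" using False by (simp add: s abs_mult mult_left_mono)
  then show ?thesis using rect_perpendicular_product_ordered[of L q p] assms
    by (simp add: inner_commute mult.commute)
qed

lemma Lambda_tilde_rect_ge:
  assumes "L \<ge> 1"
  shows "Lambda_tilde (rect L) \<ge> L / (L + 1 / L)"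
proof -
  have K: "rect L \<in> sym_convex_bodies" using assms by (intro rect_sym_convex_body) simp
  obtain w1 w2 where w: "orthogonal_basis w1 w2" "Lambda_tilde (rect L) = section_ratio (rect L) w1 w2"
    using Lambda_tilde_attained[OF K] by blast
  have w': "w1 \<noteq> 0" "w2 \<noteq> 0" "w1 \<bullet> w2 = 0"
    using w(1) by (auto simp: orthogonal_basis_iff orthogonal_def)
  obtain s t where st:
    "s *\<^sub>R rot w1 \<in> rect L" "line_length w1 (rect L \<inter> {w1}\<^sup>\<bottom>) = 2 * norm (s *\<^sub>R rot w1)"
    "t *\<^sub>R rot w2 \<in> rect L" "line_length w2 (rect L \<inter> {w2}\<^sup>\<bottom>) = 2 * norm (t *\<^sub>R rot w2)"
    "s \<noteq> 0" "t \<noteq> 0"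
    using chord_endpoint[OF K w'(1)] chord_endpoint[OF K w'(2)] by metis
  define P where "P = norm (s *\<^sub>R rot w1) * norm (t *\<^sub>R rot w2)"
  have "P \<le> L + 1 / L"
    unfolding P_def using assms st w' by (intro rect_perpendicular_product) auto
  moreover have "P > 0" using st w' by (simp add: P_def)
  ultimately have "L / (L + 1 / L) \<le> L / P" using assms by (intro divide_left_mono) auto
  also have "\<dots> = (4 * L) / ((2 * norm (s *\<^sub>R rot w1)) * (2 * norm (t *\<^sub>R rot w2)))"
    by (simp add: P_def)
  also have "\<dots> = Lambda_tilde (rect L)"
    unfolding w(2) section_ratio_def st(2,4) using measure_rect assms by simp
  finally show ?thesis .
qed

section \<open>The supremum\<close>

theorem proposition4p1:
  shows "Lambda_tilde_0 = 1 \<and> \<not> (\<exists>K\<in>sym_convex_bodies. Lambda_tilde K = 1)"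
proof
  show "\<not> (\<exists>K\<in>sym_convex_bodies. Lambda_tilde K = 1)"
    using Lambda_tilde_less_1 by force
  have "Lambda_tilde_0 \<le> 1"
    unfolding Lambda_tilde_0_def using Lambda_tilde_less_1 by (intro SUP_least) (auto simp: less_imp_le)
  moreover have "1 \<le> Lambda_tilde_0"
  proof (rule LIMSEQ_le_const2)
    show "(\<lambda>n. ereal (1 + - inverse (real (Suc n)))) \<longlonglongrightarrow> 1"
      using LIMSEQ_inverse_real_of_nat_add_minus[of 1] by (simp only: one_ereal_def tendsto_ereal)
    have "ereal (1 + - inverse (real (Suc n))) \<le> Lambda_tilde_0" for n
    proof -
      define L where "L = real (Suc n)"
      have L: "L \<ge> 1" by (simp add: L_def)
      have "0 < L * L + 1" by (simp add: add_nonneg_pos)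
      then have "L / (L + 1 / L) = 1 - 1 / (L * L + 1)"
        using L by (simp add: field_simps)
      moreover have "L \<le> L * L + 1"
        using mult_right_mono[of 1 L L] L by linarith
      then have "1 / (L * L + 1) \<le> 1 / L"
        using L by (intro divide_left_mono) auto
      ultimately have "1 + - inverse L \<le> L / (L + 1 / L)"
        by (simp add: inverse_eq_divide)
      also have "\<dots> \<le> Lambda_tilde (rect L)" using Lambda_tilde_rect_ge[OF L] .
      finally show ?thesis
        unfolding Lambda_tilde_0_def L_def[symmetric]
        using rect_sym_convex_body[of L] L by (intro SUP_upper2[of "rect L"]) auto
    qed
    then show "\<exists>N. \<forall>n\<ge>N. ereal (1 + - inverse (real (Suc n))) \<le> Lambda_tilde_0" by blast
  qed
  ultimately show "Lambda_tilde_0 = 1" by (rule antisym)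
qed

end
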